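(* Let $\Lambda$ be a real infinite-dimensional Hilbert space, let $\mathcal{C}\subset\Lambda$ be a non-empty, closed, bounded and convex subset, and let $J:\Lambda\to\mathbb{R}$ be a lower semi-continuous and convex functional. Then $J$ achieves its minimum in $\mathcal{C}$, i.e., there exists $\bar{\lambda}\in\mathcal{C}$ such that $J(\bar{\lambda})=\inf_{\lambda\in\mathcal{C}}J(\lambda)$.
   Context: A functional $J$ on a topological space $\Lambda$ is lower semi-continuous if for each $a\in\mathbb{R}$ the sublevel set $\{\lambda\in\Lambda: J(\lambda)\le a\}$ is closed in $\Lambda$. Here "closed" and "lower semi-continuous" refer to the strong (norm) topology of $\Lambda$. *)

theory Defs
  imports "HOL-Analysis.Analysis"
begin

definition lower_semicontinuous :: "('a::topological_space \<Rightarrow> real) \<Rightarrow> bool" where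
  "lower_semicontinuous J \<longleftrightarrow> (\<forall>a. closed {x. J x \<le> a})"

(* The library's "dim" does not express this: it is a natural
   number and returns 0 on spaces without a finite basis. *)
definition infinite_dimensional :: "'a::real_vector itself \<Rightarrow> bool" where
  "infinite_dimensional _ \<longleftrightarrow> \<not> (\<exists>B::'a set. finite B \<and> span B = UNIV)"

end

theory Submission
  imports Defs
begin

text \<open>
  In the weak topology bounded closed convex sets are compact; the same effect is obtained here from
  completeness and the parallelogram law alone. Take a minimising sequence in \<open>C\<close> and consider the
  points of \<open>C\<close> at which \<open>J\<close> is no larger than at each of the first \<open>n\<close> members of the sequence.
  Convexity and lower semi-continuity of \<open>J\<close> make these sets convex and closed, and they decrease
  with \<open>n\<close>. By \<open>decreasing_closed_convex_nonempty_Inter\<close> they have a common point, and the value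
  of \<open>J\<close> there is a lower bound for the values along the minimising sequence, hence the minimum.
  The infimum is taken in the extended reals, so that \<open>J\<close> need not be known beforehand to be bounded
  below on \<open>C\<close>.
\<close>

text \<open>
  In a convex set, two points whose norm is nearly minimal are near to each other: their midpoint
  lies in the set too, so the parallelogram law leaves little room for their difference.
\<close>

lemma almost_minimal_norm_points_close:
  fixes x y :: "'a::real_inner"
  assumes "convex S" "x \<in> S" "y \<in> S" and lower: "\<And>z. z \<in> S \<Longrightarrow> e \<le> (norm z)\<^sup>2"
  shows "(dist x y)\<^sup>2 \<le> 2 * ((norm x)\<^sup>2 - e) + 2 * ((norm y)\<^sup>2 - e)"
proof -
  have "(1/2) *\<^sub>R x + (1/2) *\<^sub>R y \<in> S"
    using assms by (intro convexD) auto
  then have "(1/2) *\<^sub>R (x + y) \<in> S"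
    by (simp add: scaleR_add_right)
  from lower[OF this] have "4 * e \<le> (norm (x + y))\<^sup>2"
    by (simp add: power_divide)
  moreover have "(norm (x + y))\<^sup>2 + (dist x y)\<^sup>2 = 2 * (norm x)\<^sup>2 + 2 * (norm y)\<^sup>2"
    by (simp add: dist_norm power2_norm_eq_inner inner_add inner_diff inner_commute)
  ultimately show ?thesis by (simp add: algebra_simps)
qed

text \<open>
  The infima of the squared norms over the sets increase with \<open>n\<close> and are bounded, hence form a Cauchy
  sequence. Points of the sets whose squared norms approach these infima therefore form a Cauchy
  sequence themselves, and its limit lies in every set of the family.
\<close>

lemma decreasing_closed_convex_nonempty_Inter:
  fixes S :: "nat \<Rightarrow> 'a::{real_inner, complete_space} set"
  assumes ne: "\<And>n. S n \<noteq> {}" and cl: "\<And>n. closed (S n)" and cv: "\<And>n. convex (S n)"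
    and dec: "decseq S" and bd: "bounded (S 0)"
  shows "(\<Inter>n. S n) \<noteq> {}"
proof -
  define e where "e n = (INF x\<in>S n. (norm x)\<^sup>2)" for n
  have bdd: "bdd_below ((\<lambda>x. (norm x)\<^sup>2) ` S n)" for n
    by (rule bdd_belowI[of _ 0]) auto
  have lower: "e n \<le> (norm z)\<^sup>2" if "z \<in> S n" for n z
    unfolding e_def using bdd that by (rule cINF_lower)
  have sub: "S n \<subseteq> S m" if "m \<le> n" for m n
    using dec that by (simp add: decseq_def)
  have e_mono: "incseq e"
    unfolding incseq_def e_def using ne bdd sub by (intro allI impI cINF_superset_mono) auto
  obtain B where B: "\<And>x. x \<in> S 0 \<Longrightarrow> norm x \<le> B"
    using bd unfolding bounded_iff by blast
  have "e n \<le> B\<^sup>2" for n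
  proof -
    obtain x where x: "x \<in> S n" using ne by blast
    have "norm x \<le> B" using x sub[of 0 n] by (intro B) auto
    then have "(norm x)\<^sup>2 \<le> B\<^sup>2" by (rule power_mono) simp
    with lower[OF x] show ?thesis by (rule order_trans)
  qed
  then obtain L where L: "e \<longlonglongrightarrow> L" and le_L: "\<And>n. e n \<le> L"
    using incseq_convergent[OF e_mono, of "B\<^sup>2"] by blast
  have "\<exists>x\<in>S n. (norm x)\<^sup>2 < e n + 1 / Suc n" for n
    using cINF_less_iff[OF ne bdd, of n "e n + 1 / Suc n"] by (simp add: e_def)
  then obtain x where xS: "\<And>n. x n \<in> S n" and x: "\<And>n. (norm (x n))\<^sup>2 < e n + 1 / Suc n"
    by metis
  \<comment> \<open>Both points lie in \<open>S N\<close>, and their squared norms exceed \<open>e N\<close> by at most \<open>L - e N + 1 / Suc N\<close>.\<close>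
  have close: "(dist (x m) (x n))\<^sup>2 \<le> 4 * (L - e N + 1 / Suc N)" if "m \<ge> N" "n \<ge> N" for m n N
  proof -
    have norm_le: "(norm (x k))\<^sup>2 \<le> L + 1 / Suc N" if "k \<ge> N" for k
    proof -
      have "1 / real (Suc k) \<le> 1 / real (Suc N)" using that by (simp add: frac_le)
      then show ?thesis using x[of k] le_L[of k] by linarith
    qed
    have "x m \<in> S N" "x n \<in> S N" using that xS sub by blast+
    then have "(dist (x m) (x n))\<^sup>2 \<le> 2 * ((norm (x m))\<^sup>2 - e N) + 2 * ((norm (x n))\<^sup>2 - e N)"
      by (rule almost_minimal_norm_points_close[OF cv[of N] _ _ lower])
    also have "\<dots> \<le> 2 * (L + 1 / Suc N - e N) + 2 * (L + 1 / Suc N - e N)"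
      by (intro add_mono mult_left_mono diff_right_mono norm_le that) simp_all
    also have "\<dots> = 4 * (L - e N + 1 / Suc N)"
      by (simp only: mult_2 distrib_left right_diff_distrib mult_2_right)
    finally show ?thesis .
  qed
  have "(\<lambda>N. 4 * (L - e N + 1 / real (Suc N))) \<longlonglongrightarrow> 4 * (L - L + 0)"
    using LIMSEQ_Suc[OF lim_1_over_n] by (intro tendsto_intros L) simp
  then have gap: "(\<lambda>N. 4 * (L - e N + 1 / real (Suc N))) \<longlonglongrightarrow> 0" by simp
  have "Cauchy x"
  proof (rule metric_CauchyI)
    fix \<epsilon> :: real assume "\<epsilon> > 0"
    then have "\<forall>\<^sub>F N in sequentially. 4 * (L - e N + 1 / real (Suc N)) < \<epsilon>\<^sup>2"
      by (intro order_tendstoD[OF gap]) simp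
    then obtain N where N: "4 * (L - e N + 1 / real (Suc N)) < \<epsilon>\<^sup>2"
      by (auto simp: eventually_sequentially)
    have "dist (x m) (x n) < \<epsilon>" if "m \<ge> N" "n \<ge> N" for m n
    proof (rule power_less_imp_less_base)
      show "(dist (x m) (x n))\<^sup>2 < \<epsilon>\<^sup>2" using close[OF that] N by (rule le_less_trans)
    qed (use \<open>\<epsilon> > 0\<close> in simp)
    then show "\<exists>M. \<forall>m\<ge>M. \<forall>n\<ge>M. dist (x m) (x n) < \<epsilon>" by blast
  qed
  then obtain l where l: "x \<longlonglongrightarrow> l" by (auto simp: Cauchy_convergent_iff convergent_def)
  have "l \<in> S n" for n
  proof (rule Lim_in_closed_set[OF cl _ _ l])
    show "\<forall>\<^sub>F k in sequentially. x k \<in> S n"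
      using xS sub by (intro eventually_sequentiallyI[of n]) blast
  qed simp
  then show ?thesis by blast
qed

lemma convex_on_UNIV_sublevel:
  assumes "convex_on UNIV J"
  shows "convex {x. J x \<le> a}"
proof (rule convexI)
  fix x y and u v :: real
  assume "x \<in> {x. J x \<le> a}" "y \<in> {x. J x \<le> a}" "0 \<le> u" "0 \<le> v" "u + v = 1"
  moreover from this have "J (u *\<^sub>R x + v *\<^sub>R y) \<le> u * J x + v * J y"
    using assms by (simp add: convex_on_def)
  ultimately show "u *\<^sub>R x + v *\<^sub>R y \<in> {x. J x \<le> a}"
    using convex_bound_le[of "J x" a "J y" u v] by simp
qed

theorem theorem6:
  fixes C :: "'a::{real_inner, complete_space} set"
    and J :: "'a \<Rightarrow> real"
  assumes "infinite_dimensional TYPE('a)"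
    and "C \<noteq> {}" and "closed C" and "bounded C" and "convex C"
    and "lower_semicontinuous J"
    and "convex_on UNIV J"
  shows "\<exists>l\<in>C. ereal (J l) = (INF x\<in>C. ereal (J x))"
proof -
  let ?m = "INF x\<in>C. ereal (J x)"
  obtain u where "\<And>n. u n \<in> (\<lambda>x. ereal (J x)) ` C" and u: "u \<longlonglongrightarrow> ?m"
    using Inf_as_limit[of "(\<lambda>x. ereal (J x)) ` C"] \<open>C \<noteq> {}\<close> by auto
  then have "\<forall>n. \<exists>y\<in>C. u n = ereal (J y)" by blast
  then obtain y where yC: "\<And>n. y n \<in> C" and uy: "\<And>n. u n = ereal (J (y n))" by metis
  define S where "S n = C \<inter> (\<Inter>k\<le>n. {x. J x \<le> J (y k)})" for n
  have "(\<Inter>n. S n) \<noteq> {}"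
  proof (rule decreasing_closed_convex_nonempty_Inter)
    fix n
    \<comment> \<open>The best of the first members of the minimising sequence belongs to \<open>S n\<close>.\<close>
    obtain j where "is_arg_min (\<lambda>k. J (y k)) (\<lambda>k. k \<in> {..n}) j"
      using ex_is_arg_min_if_finite[of "{..n}" "\<lambda>k. J (y k)"] by auto
    then have "\<And>k. k \<le> n \<Longrightarrow> J (y j) \<le> J (y k)"
      by (simp add: is_arg_min_linorder)
    then show "S n \<noteq> {}" using yC unfolding S_def by blast
    show "closed (S n)"
      using \<open>closed C\<close> \<open>lower_semicontinuous J\<close>
      unfolding S_def lower_semicontinuous_def by (intro closed_Int closed_INT) auto
    show "convex (S n)"
      using \<open>convex C\<close> \<open>convex_on UNIV J\<close>
      unfolding S_def by (intro convex_Int convex_INT convex_on_UNIV_sublevel)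
  next
    show "decseq S" unfolding decseq_def S_def by fastforce
    show "bounded (S 0)" using \<open>bounded C\<close> unfolding S_def by (rule bounded_subset) blast
  qed
  then obtain l where l: "\<And>n. l \<in> S n" by blast
  then have "l \<in> C" and "\<And>n. ereal (J l) \<le> u n" unfolding S_def uy by auto
  then have "ereal (J l) \<le> ?m"
    by (intro LIMSEQ_le_const[OF u]) blast
  moreover have "?m \<le> ereal (J l)" using \<open>l \<in> C\<close> by (rule INF_lower)
  ultimately show ?thesis using \<open>l \<in> C\<close> by (blast intro: antisym)
qed

end
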